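(* Let $A$ be the generator of a $C_0$-semigroup $(e^{tA})_{t\ge 0}$ on a complex Banach space $X$. Then the following are equivalent: (i) $A$ is bounded; (ii) for every bounded linear projection $P$ on $X$ (i.e. bounded linear $P:X\to X$ with $P^2=P$), every $x\in X$ and every $t\ge 0$, the limit $\lim_{n\to\infty}(e^{\frac{t}{n}A}P)^n x$ exists in $X$ (in norm). *)

theory Defs
  imports "HOL-Analysis.Analysis"
begin

text \<open>Complex Banach spaces: HOL has no complex vector space class, so we add one.
A complex Banach space is a real Banach space with a complex scalar multiplication
extending the real one and compatible with the norm.\<close>

class complex_scale = fixes scaleC :: "complex \<Rightarrow> 'a \<Rightarrow> 'a" (infixr "*\<^sub>C" 75)

class complex_banach = banach + complex_scale +
  assumes scaleC_add_right: "a *\<^sub>C (x + y) = a *\<^sub>C x + a *\<^sub>C y"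
    and scaleC_add_left: "(a + b) *\<^sub>C x = a *\<^sub>C x + b *\<^sub>C x"
    and scaleC_scaleC: "a *\<^sub>C (b *\<^sub>C x) = (a * b) *\<^sub>C x"
    and scaleC_one: "1 *\<^sub>C x = x"
    and scaleC_of_real: "complex_of_real r *\<^sub>C x = r *\<^sub>R x"
    and norm_scaleC: "norm (a *\<^sub>C x) = cmod a * norm x"

definition bounded_clinear_op :: "('a::complex_banach \<Rightarrow> 'a) \<Rightarrow> bool" where
  "bounded_clinear_op f \<longleftrightarrow> bounded_linear f \<and> (\<forall>c x. f (c *\<^sub>C x) = c *\<^sub>C f x)"

definition c0_semigroup :: "(real \<Rightarrow> 'a::complex_banach \<Rightarrow> 'a) \<Rightarrow> bool" where
  "c0_semigroup T \<longleftrightarrow>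
     (\<forall>t\<ge>0. bounded_clinear_op (T t)) \<and>
     T 0 = id \<and>
     (\<forall>s\<ge>0. \<forall>t\<ge>0. T (s + t) = T s \<circ> T t) \<and>
     (\<forall>x. ((\<lambda>t. T t x) \<longlongrightarrow> x) (at_right 0))"

definition gen_domain :: "(real \<Rightarrow> 'a::complex_banach \<Rightarrow> 'a) \<Rightarrow> 'a set" where
  "gen_domain T = {x. \<exists>y. ((\<lambda>h. (1 / h) *\<^sub>R (T h x - x)) \<longlongrightarrow> y) (at_right 0)}"

definition generator :: "(real \<Rightarrow> 'a::complex_banach \<Rightarrow> 'a) \<Rightarrow> 'a \<Rightarrow> 'a" where
  "generator T x = Lim (at_right 0) (\<lambda>h. (1 / h) *\<^sub>R (T h x - x))"

definition bounded_generator :: "(real \<Rightarrow> 'a::complex_banach \<Rightarrow> 'a) \<Rightarrow> bool" where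
  "bounded_generator T \<longleftrightarrow>
     gen_domain T = UNIV \<and> (\<exists>C. \<forall>x. norm (generator T x) \<le> C * norm x)"

definition bounded_projection :: "('a::complex_banach \<Rightarrow> 'a) \<Rightarrow> bool" where
  "bounded_projection P \<longleftrightarrow> bounded_clinear_op P \<and> P \<circ> P = P"

end

theory Submission
  imports Defs
begin

text \<open>Boundedness of the generator and condition (ii) are both compared with the Lipschitz
  estimate \<open>\<parallel>T(h) - I\<parallel> \<le> C h\<close> for \<open>0 \<le> h \<le> 1\<close>. A bounded generator gives the estimate by
  uniform boundedness. From the estimate, \<open>T(m h) - I = m (T(h) - I) + O((m h)\<^sup>2)\<close>, which shows that
  the difference quotients converge, and that the powers of \<open>H(s) = I + P (T(s) - I)\<close> with
  \<open>s = t/n\<close> form a Cauchy sequence; on the range of \<open>P\<close>, \<open>H(s)\<close> is \<open>P T(s)\<close>.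
  Conversely, apply (ii) to the rank-one projections \<open>P y = \<phi>(y) w\<close> with \<open>\<phi>(w) = 1\<close>. It bounds
  the scalars \<open>\<phi>(T(1/n) w)\<^sup>n\<close>, hence bounds \<open>Re \<phi>(n (T(1/n) - I) w)\<close> from above. Taking
  \<open>w = v \<plusminus> y\<close> with a fixed \<open>v\<close> in the domain and \<open>\<phi>(y) = 0\<close> gives a two-sided bound, so
  \<open>n (T(1/n) - I)\<close> is weakly bounded, and by uniform boundedness it is bounded in norm.\<close>

subsection \<open>Uniform boundedness\<close>

text \<open>The closed sets \<open>S k\<close> cover the space, so by Baire some \<open>S k\<close>
  contains a ball around \<open>x0\<close>. Every vector of norm \<open>r\<close> is a difference of
  two points of that ball, which bounds all \<open>F i\<close> on the sphere of radius
  \<open>r\<close>.\<close>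

lemma uniform_boundedness:
  fixes F :: "'i \<Rightarrow> 'a::banach \<Rightarrow> 'b::real_normed_vector"
  assumes lin: "\<And>i. i \<in> I \<Longrightarrow> bounded_linear (F i)"
    and bd: "\<And>x. \<exists>K. \<forall>i\<in>I. norm (F i x) \<le> K"
  shows "\<exists>K\<ge>0. \<forall>i\<in>I. \<forall>x. norm (F i x) \<le> K * norm x"
proof -
  define S where "S k = {x. \<forall>i\<in>I. norm (F i x) \<le> real k}" for k :: nat
  have closed_S: "closed (S k)" for k
  proof -
    have "S k = (\<Inter>i\<in>I. {x. norm (F i x) \<le> real k})"
      by (auto simp: S_def)
    moreover have "closed {x. norm (F i x) \<le> real k}" if "i \<in> I" for i
      using lin[OF that]
      by (intro closed_Collect_le continuous_intros linear_continuous_on)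
    ultimately show ?thesis by auto
  qed
  have cover: "(\<Union>k. S k) = UNIV"
  proof -
    have "x \<in> (\<Union>k. S k)" for x
    proof -
      obtain K where "\<forall>i\<in>I. norm (F i x) \<le> K" using bd by blast
      moreover obtain k where "K \<le> real k" using real_arch_simple by blast
      ultimately have "x \<in> S k" unfolding S_def by force
      then show ?thesis by blast
    qed
    then show ?thesis by blast
  qed
  have "\<exists>k. interior (S k) \<noteq> {}"
  proof (rule ccontr)
    assume "\<not> ?thesis"
    then have "euclidean interior_of \<Union>(range S) = {}"
      using closed_S
      by (intro Baire_category_alt) (auto simp: completely_metrizable_space_euclidean)
    then show False using cover by simp
  qed
  then obtain k x0 where "x0 \<in> interior (S k)" by blast
  then obtain r where r: "r > 0" "cball x0 r \<subseteq> S k"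
    by (meson mem_interior_cball)
  have "norm (F i x) \<le> (2 * k / r) * norm x" if i: "i \<in> I" for i x
  proof (cases "x = 0")
    case True
    then show ?thesis using lin[OF i] by (simp add: linear_simps)
  next
    case False
    interpret bounded_linear "F i" by (rule lin[OF i])
    define y where "y = (r / norm x) *\<^sub>R x"
    have "x0 + y \<in> S k" "x0 \<in> S k"
      using r False by (auto simp: y_def dist_norm intro!: subsetD[OF r(2)])
    then have "norm (F i (x0 + y)) \<le> real k" "norm (F i x0) \<le> real k"
      using i by (auto simp: S_def)
    moreover have "F i y = F i (x0 + y) - F i x0" by (simp add: add)
    ultimately have "norm (F i y) \<le> 2 * real k"
      using norm_triangle_ineq4[of "F i (x0 + y)" "F i x0"] by simp
    moreover have "norm (F i y) = (r / norm x) * norm (F i x)"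
      using r by (simp add: y_def scaleR)
    ultimately show ?thesis using r False by (simp add: field_simps)
  qed
  then show ?thesis using r(1) by (intro exI[of _ "2 * k / r"]) auto
qed

subsection \<open>The Hahn--Banach theorem\<close>

text \<open>Homogeneity is asked only as an inequality, the form that infima satisfy directly;
  \<open>sublinear_scaleR\<close> recovers equality.\<close>

definition sublinear :: "('a::real_vector \<Rightarrow> real) \<Rightarrow> bool" where
  "sublinear p \<longleftrightarrow> (\<forall>x y. p (x + y) \<le> p x + p y) \<and> (\<forall>c\<ge>0. \<forall>x. p (c *\<^sub>R x) \<le> c * p x)"

lemma sublinear_add: "sublinear p \<Longrightarrow> p (x + y) \<le> p x + p y"
  and sublinear_scaleR_le: "sublinear p \<Longrightarrow> c \<ge> 0 \<Longrightarrow> p (c *\<^sub>R x) \<le> c * p x"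
  by (auto simp: sublinear_def)

lemma sublinear_zero: "sublinear p \<Longrightarrow> p 0 = 0"
  using sublinear_add[of p 0 0] sublinear_scaleR_le[of p 0 0] by simp

lemma sublinear_minus: "sublinear p \<Longrightarrow> - p (- x) \<le> p x"
  using sublinear_add[of p x "- x"] sublinear_zero[of p] by simp

lemma sublinear_scaleR:
  assumes "sublinear p" "c \<ge> 0" shows "p (c *\<^sub>R x) = c * p x"
proof (cases "c = 0")
  case False
  have "p x \<le> (1 / c) * p (c *\<^sub>R x)"
    using sublinear_scaleR_le[OF assms(1), of "1 / c" "c *\<^sub>R x"] assms(2) False by simp
  then have "c * p x \<le> p (c *\<^sub>R x)"
    using assms(2) False by (simp add: field_simps)
  then show ?thesis using sublinear_scaleR_le[OF assms] by (simp add: order_antisym)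
qed (simp add: sublinear_zero[OF assms(1)])

text \<open>For sublinear \<open>p\<close>, the choice \<open>t = 0\<close> shows that this lies
  below \<open>p\<close>, and \<open>t = 1\<close> bounds its value at \<open>- z\<close> by
  \<open>- p z\<close>. So a linear functional below it is below \<open>p\<close> and equals
  \<open>p z\<close> at \<open>z\<close>.\<close>

definition directional_inf :: "('a::real_vector \<Rightarrow> real) \<Rightarrow> 'a \<Rightarrow> 'a \<Rightarrow> real" where
  "directional_inf p z x = (INF t\<in>{0..}. p (x + t *\<^sub>R z) - t * p z)"

lemma directional_inf_bdd:
  assumes "sublinear p"
  shows "bdd_below ((\<lambda>t. p (x + t *\<^sub>R z) - t * p z) ` {0..})"
proof (rule bdd_belowI2)
  fix t :: real assume "t \<in> {0..}"
  then show "- p (- x) \<le> p (x + t *\<^sub>R z) - t * p z"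
    using sublinear_add[OF assms, of "x + t *\<^sub>R z" "- x"] sublinear_scaleR[OF assms, of t z]
    by simp
qed

lemma directional_inf_le:
  assumes "sublinear p" "t \<ge> 0"
  shows "directional_inf p z x \<le> p (x + t *\<^sub>R z) - t * p z"
  unfolding directional_inf_def using assms by (intro cINF_lower directional_inf_bdd) auto

text \<open>For subadditivity, arbitrary parameters \<open>s\<close> for \<open>x\<close> and
  \<open>t\<close> for \<open>y\<close> are compared with \<open>s + t\<close> for
  \<open>x + y\<close>; for homogeneity, \<open>t\<close> for \<open>x\<close> with
  \<open>c * t\<close> for the multiple by \<open>c\<close>.\<close>

lemma sublinear_directional_inf:
  assumes p: "sublinear p"
  shows "sublinear (directional_inf p z)"
  unfolding sublinear_def
proof (intro conjI allI impI)
  fix x y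
  let ?q = "directional_inf p z"
  have "?q (x + y) - (p (y + t *\<^sub>R z) - t * p z) \<le> p (x + s *\<^sub>R z) - s * p z"
    if "s \<ge> 0" "t \<ge> 0" for s t
    using directional_inf_le[OF p, of "s + t" z "x + y"] that
      sublinear_add[OF p, of "x + s *\<^sub>R z" "y + t *\<^sub>R z"]
    by (simp add: algebra_simps)
  then have "?q (x + y) - (p (y + t *\<^sub>R z) - t * p z) \<le> ?q x" if "t \<ge> 0" for t
    unfolding directional_inf_def[of p z x] using that by (intro cINF_greatest) auto
  then have "?q (x + y) - ?q x \<le> p (y + t *\<^sub>R z) - t * p z" if "t \<ge> 0" for t
    using that by (smt (verit))
  then have "?q (x + y) - ?q x \<le> ?q y"
    unfolding directional_inf_def[of p z y] by (intro cINF_greatest) auto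
  then show "?q (x + y) \<le> ?q x + ?q y" by simp
next
  fix c :: real and x assume c: "c \<ge> 0"
  let ?q = "directional_inf p z"
  show "?q (c *\<^sub>R x) \<le> c * ?q x"
  proof (cases "c = 0")
    case True
    then show ?thesis using directional_inf_le[OF p, of 0 z 0] sublinear_zero[OF p] by simp
  next
    case False
    have "?q (c *\<^sub>R x) / c \<le> p (x + t *\<^sub>R z) - t * p z" if "t \<ge> 0" for t
      using directional_inf_le[OF p, of "c * t" z "c *\<^sub>R x"] that c False
        sublinear_scaleR[OF p, of c "x + t *\<^sub>R z"]
      by (simp add: field_simps scaleR_add_right)
    then have "?q (c *\<^sub>R x) / c \<le> ?q x"
      unfolding directional_inf_def[of p z x] by (intro cINF_greatest) auto
    then show ?thesis using c False by (simp add: field_simps)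
  qed
qed

text \<open>The pointwise infimum works; it is finite because
  \<open>q x \<ge> - q (- x) \<ge> - p (- x)\<close>. Subadditivity is where the chain matters: of
  two members, the smaller one serves for both \<open>x\<close> and \<open>y\<close>.\<close>

lemma sublinear_chain_lower_bound:
  fixes p :: "'a::real_vector \<Rightarrow> real"
  assumes ne: "C \<noteq> {}"
    and sub: "\<And>q. q \<in> C \<Longrightarrow> sublinear q \<and> (\<forall>x. q x \<le> p x)"
    and chain: "\<And>q r. q \<in> C \<Longrightarrow> r \<in> C \<Longrightarrow> (\<forall>x. q x \<le> r x) \<or> (\<forall>x. r x \<le> q x)"
  shows "\<exists>u. sublinear u \<and> (\<forall>q\<in>C. \<forall>x. u x \<le> q x)"
proof -
  define u where "u x = (INF q\<in>C. q x)" for x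
  have bdd: "bdd_below ((\<lambda>q. q x) ` C)" for x
  proof (rule bdd_belowI2)
    fix q assume "q \<in> C"
    then show "- p (- x) \<le> q x"
      using sub[of q] sublinear_minus[of q x] by (smt (verit))
  qed
  have le: "u x \<le> q x" if "q \<in> C" for q x
    unfolding u_def using that by (intro cINF_lower bdd) auto
  have "sublinear u"
    unfolding sublinear_def
  proof (intro conjI allI impI)
    fix x y
    have *: "u (x + y) - r y \<le> q x" if "q \<in> C" "r \<in> C" for q r
    proof -
      obtain s where s: "s \<in> C" "s x \<le> q x" "s y \<le> r y"
        using chain[OF \<open>q \<in> C\<close> \<open>r \<in> C\<close>] \<open>q \<in> C\<close> \<open>r \<in> C\<close> by (meson order_refl)
      then show ?thesis
        using le[OF s(1), of "x + y"] sublinear_add[of s x y] sub[OF s(1)] by linarith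
    qed
    then have "u (x + y) - r y \<le> u x" if "r \<in> C" for r
      unfolding u_def[of x] using that ne by (intro cINF_greatest) auto
    then have "u (x + y) - u x \<le> u y"
      unfolding u_def[of y] using ne by (intro cINF_greatest) (auto simp: algebra_simps)
    then show "u (x + y) \<le> u x + u y" by simp
  next
    fix c :: real and x assume c: "c \<ge> 0"
    show "u (c *\<^sub>R x) \<le> c * u x"
    proof (cases "c = 0")
      case True
      obtain q where "q \<in> C" using ne by blast
      then show ?thesis using le[of q 0] sub[of q] sublinear_zero[of q] True by simp
    next
      case False
      have "u (c *\<^sub>R x) / c \<le> q x" if "q \<in> C" for q
        using le[OF that, of "c *\<^sub>R x"] sub[OF that] sublinear_scaleR[of q c x] c False
        by (simp add: field_simps)
      then have "u (c *\<^sub>R x) / c \<le> u x"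
        unfolding u_def[of x] using ne by (intro cINF_greatest) auto
      then show ?thesis using c False by (simp add: field_simps)
    qed
  qed
  then show ?thesis using le by blast
qed

text \<open>A minimal sublinear functional \<open>q\<close> is linear: it equals its directional infima, so
  \<open>q x \<le> q (x + z) - q z\<close>.\<close>

theorem hahn_banach_dominated:
  fixes p :: "'a::real_vector \<Rightarrow> real"
  assumes p: "sublinear p"
  shows "\<exists>f. linear f \<and> (\<forall>x. f x \<le> p x)"
proof -
  define A where "A = {q. sublinear q \<and> (\<forall>x. q x \<le> p x)}"
  \<comment> \<open>The order is reversed, so that the maximal element from Zorn's lemma is a
    pointwise minimal functional.\<close>
  define R where "R q r \<longleftrightarrow> (\<forall>x. r x \<le> q x)" for q r :: "'a \<Rightarrow> real"
  have "\<exists>m\<in>A. \<forall>a\<in>A. R m a \<longrightarrow> a = m"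
  proof (rule predicate_Zorn)
    show "partial_order_on A (relation_of R A)"
      by (rule partial_order_on_relation_ofI) (auto simp: R_def fun_eq_iff intro: order_trans order_antisym)
  next
    fix C assume C: "C \<in> Chains (relation_of R A)"
    have CA: "C \<subseteq> A" using C by (auto simp: Chains_def relation_of_def)
    show "\<exists>u\<in>A. \<forall>a\<in>C. R a u"
    proof (cases "C = {}")
      case True
      then show ?thesis using p by (auto simp: A_def)
    next
      case False
      have "\<exists>u. sublinear u \<and> (\<forall>q\<in>C. \<forall>x. u x \<le> q x)"
      proof (rule sublinear_chain_lower_bound[OF False, of p])
        show "sublinear q \<and> (\<forall>x. q x \<le> p x)" if "q \<in> C" for q
          using CA that by (auto simp: A_def)
        show "(\<forall>x. q x \<le> r x) \<or> (\<forall>x. r x \<le> q x)" if "q \<in> C" "r \<in> C" for q r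
          using C that by (auto simp: Chains_def relation_of_def R_def)
      qed
      then obtain u where u: "sublinear u" "\<forall>q\<in>C. \<forall>x. u x \<le> q x" by blast
      obtain q where q: "q \<in> C" using False by blast
      have "u x \<le> p x" for x
        using u(2) q CA unfolding A_def by (blast intro: order_trans)
      then show ?thesis using u by (auto simp: A_def R_def)
    qed
  qed
  then obtain m where "m \<in> A" and max: "\<And>q. q \<in> A \<Longrightarrow> R m q \<Longrightarrow> q = m" by blast
  then have m: "sublinear m" "\<And>x. m x \<le> p x" by (auto simp: A_def)
  have min: "q = m" if "sublinear q" "\<And>x. q x \<le> m x" for q
    using that m(2) by (intro max) (auto simp: A_def R_def intro: order_trans)
  have "directional_inf m z = m" for z
    using directional_inf_le[OF m(1), of 0] by (intro min sublinear_directional_inf m) auto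
  then have "m x \<le> m (x + z) - m z" for x z
    using directional_inf_le[OF m(1), of 1 z x] by simp
  then have add: "m (x + z) = m x + m z" for x z
    using sublinear_add[OF m(1), of x z] by (smt (verit))
  have neg: "m (- x) = - m x" for x
    using add[of x "- x"] sublinear_zero[OF m(1)] by simp
  have "linear m"
  proof (rule linearI)
    show "m (c *\<^sub>R x) = c *\<^sub>R m x" for c x
    proof (cases "c \<ge> 0")
      case True
      then show ?thesis using sublinear_scaleR[OF m(1)] by simp
    next
      case False
      then show ?thesis using sublinear_scaleR[OF m(1), of "- c" x] neg[of "c *\<^sub>R x"] by simp
    qed
  qed (rule add)
  then show ?thesis using m(2) by blast
qed

text \<open>Hahn-Banach is applied to \<open>directional_inf norm z\<close> instead of the norm:
  this keeps \<open>f\<close> below the norm and also forces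
  \<open>f (- z) \<le> - norm z\<close>.\<close>

corollary norming_functional:
  fixes z :: "'a::real_normed_vector"
  shows "\<exists>f. bounded_linear f \<and> (\<forall>x. \<bar>f x\<bar> \<le> norm x) \<and> f z = norm z"
proof -
  have sub: "sublinear (norm :: 'a \<Rightarrow> real)"
    by (simp add: sublinear_def norm_triangle_ineq)
  obtain f where f: "linear f" "\<And>x. f x \<le> directional_inf norm z x"
    using hahn_banach_dominated[OF sublinear_directional_inf[OF sub]] by blast
  have le: "f x \<le> norm x" for x
    using f(2)[of x] directional_inf_le[OF sub, of 0 z x] by simp
  have "f (- z) \<le> - norm z"
    using f(2)[of "- z"] directional_inf_le[OF sub, of 1 z "- z"] by simp
  then have "f z = norm z"
    using le[of z] linear_neg[OF f(1)] by simp
  moreover have abs: "\<bar>f x\<bar> \<le> norm x" for x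
    using le[of x] le[of "- x"] linear_neg[OF f(1)] by (simp add: abs_le_iff)
  moreover have "bounded_linear f"
    using f(1) abs by (intro bounded_linear_intro[of _ 1]) (auto simp: linear_add linear_cmul)
  ultimately show ?thesis by blast
qed

text \<open>Each \<open>x\<close> in \<open>S\<close> acts by evaluation on the dual space, which is
  complete, so uniform boundedness applies there. A norming functional turns the bound on
  evaluations into a bound on \<open>norm x\<close>.\<close>

lemma weakly_bounded_imp_bounded:
  fixes S :: "'a::real_normed_vector set"
  assumes "\<And>f::'a \<Rightarrow> real. bounded_linear f \<Longrightarrow> \<exists>K. \<forall>x\<in>S. \<bar>f x\<bar> \<le> K"
  shows "\<exists>K. \<forall>x\<in>S. norm x \<le> K"
proof -
  have "\<exists>K\<ge>0. \<forall>x\<in>S. \<forall>f::'a \<Rightarrow>\<^sub>L real. norm (blinfun_apply f x) \<le> K * norm f"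
    using assms[OF blinfun.bounded_linear_right]
    by (intro uniform_boundedness blinfun.bounded_linear_left) auto
  then obtain K where K: "K \<ge> 0" "\<And>x f. x \<in> S \<Longrightarrow> norm (blinfun_apply (f :: 'a \<Rightarrow>\<^sub>L real) x) \<le> K * norm f"
    by blast
  have "norm x \<le> K" if x: "x \<in> S" for x
  proof -
    obtain f where f: "bounded_linear f" "\<And>y. \<bar>f y\<bar> \<le> norm y" "f x = norm x"
      using norming_functional[of x] by blast
    have "norm (Blinfun f) \<le> 1"
      using f by (intro norm_blinfun_bound) (auto simp: bounded_linear_Blinfun_apply)
    then have "K * norm (Blinfun f) \<le> K"
      using K(1) by (simp add: mult_left_le)
    then show ?thesis
      using K(2)[OF x, of "Blinfun f"] f by (simp add: bounded_linear_Blinfun_apply)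
  qed
  then show ?thesis by blast
qed

subsection \<open>Powers of operators close to the identity\<close>

lemma funpow_norm_le:
  fixes A :: "'a::real_normed_vector \<Rightarrow> 'a"
  assumes "\<And>x. norm (A x) \<le> a * norm x" "a \<ge> 0"
  shows "norm ((A ^^ n) x) \<le> a ^ n * norm x"
proof (induction n)
  case (Suc n)
  have "norm ((A ^^ Suc n) x) \<le> a * norm ((A ^^ n) x)"
    using assms(1) by simp
  also have "\<dots> \<le> a * (a ^ n * norm x)"
    using Suc assms(2) by (intro mult_left_mono) auto
  finally show ?case by (simp add: mult.assoc)
qed simp

text \<open>Replacing one factor \<open>B\<close> by \<open>A\<close> costs \<open>d\<close>, and
  there are \<open>n\<close> replacements; the remaining factors contribute at most
  \<open>a ^ n\<close>.\<close>

lemma funpow_diff_norm_le: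
  fixes A B :: "'a::real_normed_vector \<Rightarrow> 'a"
  assumes "linear A" and A: "\<And>x. norm (A x) \<le> a * norm x" and B: "\<And>x. norm (B x) \<le> a * norm x"
    and AB: "\<And>x. norm (A x - B x) \<le> d * norm x" and "a \<ge> 1" "d \<ge> 0"
  shows "norm ((A ^^ n) x - (B ^^ n) x) \<le> real n * a ^ n * d * norm x"
proof (induction n)
  case (Suc n)
  have a0: "a \<ge> 0" using \<open>a \<ge> 1\<close> by simp
  have "(A ^^ Suc n) x - (B ^^ Suc n) x
      = A ((A ^^ n) x - (B ^^ n) x) + (A ((B ^^ n) x) - B ((B ^^ n) x))"
    using \<open>linear A\<close> by (simp add: linear_diff)
  also have "norm \<dots> \<le> a * norm ((A ^^ n) x - (B ^^ n) x) + d * norm ((B ^^ n) x)"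
    by (intro norm_triangle_mono A AB)
  also have "\<dots> \<le> a * (real n * a ^ n * d * norm x) + d * (a ^ n * norm x)"
    using Suc a0 \<open>d \<ge> 0\<close> by (intro add_mono mult_left_mono funpow_norm_le B) auto
  \<comment> \<open>The extra factor \<open>a \<ge> 1\<close> makes both terms multiples of
    \<open>a ^ Suc n\<close>.\<close>
  also have "\<dots> \<le> a * (real n * a ^ n * d * norm x) + a * (d * (a ^ n * norm x))"
    using \<open>a \<ge> 1\<close> \<open>d \<ge> 0\<close> mult_right_mono[of 1 a "d * (a ^ n * norm x)"] by simp
  also have "\<dots> = real (Suc n) * a ^ Suc n * d * norm x"
    by (simp add: algebra_simps)
  finally show ?case .
qed simp

lemma near_identity_norm_le:
  fixes H :: "'a::real_normed_vector \<Rightarrow> 'a"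
  assumes "\<And>x. norm (H x - x) \<le> a * norm x"
  shows "norm (H x) \<le> (1 + a) * norm x"
  using norm_triangle_ineq[of "H x - x" x] assms[of x] by (simp add: algebra_simps)

text \<open>This is a Taylor remainder for powers of \<open>H\<close>, with \<open>H - I\<close> of
  size \<open>a\<close>: raising the exponent by one adds \<open>(H ^^ m - I) (H x - x)\<close>, and
  both factors are of first order in \<open>a\<close>.\<close>

lemma funpow_second_order:
  fixes H :: "'a::real_normed_vector \<Rightarrow> 'a"
  assumes lin: "linear H" and H: "\<And>x. norm (H x - x) \<le> a * norm x" and a: "a \<ge> 0"
  shows "norm ((H ^^ m) x - x - real m *\<^sub>R (H x - x)) \<le> (real m * a)\<^sup>2 * exp (real m * a) * norm x"
proof -
  have pow: "norm ((H ^^ m) y - y) \<le> real m * (1 + a) ^ m * a * norm y" for m y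
    using funpow_diff_norm_le[OF lin, of "1 + a" id a m y] near_identity_norm_le[OF H] H a
    by (simp add: algebra_simps)
  have "norm ((H ^^ m) x - x - real m *\<^sub>R (H x - x)) \<le> (real m * a)\<^sup>2 * (1 + a) ^ m * norm x"
  proof (induction m)
    case (Suc m)
    let ?w = "H x - x"
    have "linear (H ^^ m)"
      by (induction m) (auto simp: o_def id_def linear_iff linear_add[OF lin] linear_cmul[OF lin])
    then have "(H ^^ Suc m) x - x - real (Suc m) *\<^sub>R ?w
        = ((H ^^ m) x - x - real m *\<^sub>R ?w) + ((H ^^ m) ?w - ?w)"
      by (simp only: funpow_Suc_right o_apply linear_diff) (simp add: algebra_simps)
    also have "norm \<dots> \<le> (real m * a)\<^sup>2 * (1 + a) ^ m * norm x + real m * (1 + a) ^ m * a * norm ?w"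
      by (intro norm_triangle_mono Suc pow)
    also have "\<dots> \<le> (real m * a)\<^sup>2 * (1 + a) ^ m * norm x + real m * (1 + a) ^ m * a * (a * norm x)"
      using a by (intro add_left_mono mult_left_mono H) auto
    also have "\<dots> = ((real m)\<^sup>2 + real m) * (a\<^sup>2 * (1 + a) ^ m * norm x)"
      by (simp add: algebra_simps power2_eq_square)
    \<comment> \<open>The induction closes because
      \<open>m\<^sup>2 + m \<le> (m + 1)\<^sup>2\<close>.\<close>
    also have "\<dots> \<le> (real (Suc m))\<^sup>2 * (a\<^sup>2 * (1 + a) ^ Suc m * norm x)"
      using a by (intro mult_mono mult_right_mono mult_left_mono power_increasing)
        (auto simp: power2_eq_square algebra_simps)
    finally show ?case by (simp add: power_mult_distrib mult.assoc)
  qed simp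
  also have "\<dots> \<le> (real m * a)\<^sup>2 * exp (real m * a) * norm x"
  proof -
    have "(1 + a) ^ m \<le> exp a ^ m"
      using a by (intro power_mono) auto
    then have "(1 + a) ^ m \<le> exp (real m * a)"
      by (simp add: exp_of_nat_mult)
    then show ?thesis by (intro mult_right_mono mult_left_mono) auto
  qed
  finally show ?thesis .
qed

text \<open>Any two indices are compared through their product.\<close>

lemma convergent_if_close_to_multiples:
  fixes a :: "nat \<Rightarrow> 'a::banach"
  assumes "\<And>n m. n \<ge> N \<Longrightarrow> n \<ge> 1 \<Longrightarrow> m \<ge> 1 \<Longrightarrow> norm (a n - a (n * m)) \<le> K / real n"
  shows "convergent a"
proof -
  have "(\<lambda>n. K / real n) \<longlonglongrightarrow> 0" by (rule lim_const_over_n)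
  have "Cauchy a"
  proof (rule metric_CauchyI)
    fix e :: real assume "e > 0"
    have "eventually (\<lambda>n. K / real n < e / 2) sequentially"
      using \<open>e > 0\<close> by (intro order_tendstoD(2)[OF \<open>(\<lambda>n. K / real n) \<longlonglongrightarrow> 0\<close>]) auto
    then obtain M where M: "\<And>n. n \<ge> M \<Longrightarrow> K / real n < e / 2"
      by (auto simp: eventually_sequentially)
    have "dist (a m) (a n) < e" if "m \<ge> max M (max N 1)" "n \<ge> max M (max N 1)" for m n
    proof -
      have "norm (a m - a (m * n)) < e / 2" "norm (a n - a (m * n)) < e / 2"
        using assms[of m n] assms[of n m] M[of m] M[of n] that
        unfolding mult.commute[of n m] by linarith+
      then show ?thesis
        unfolding dist_norm by (metis dist_commute dist_norm dist_triangle_half_r norm_minus_commute)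
    qed
    then show "\<exists>M. \<forall>m\<ge>M. \<forall>n\<ge>M. dist (a m) (a n) < e" by blast
  qed
  then show ?thesis by (simp add: Cauchy_convergent_iff)
qed

text \<open>The hypothesis \<open>H2\<close> stands in for a semigroup law: \<open>H s\<close> and
  \<open>H h ^^ m\<close> with \<open>s = m * h\<close> both differ from
  \<open>I + m (H h - I)\<close> by a term of order \<open>s\<^sup>2\<close>. With
  \<open>s = t / n\<close>, the \<open>n\<close> factors accumulate an error of order
  \<open>n * s\<^sup>2 = t\<^sup>2 / n\<close>.\<close>

lemma near_identity_powers_convergent:
  fixes H :: "real \<Rightarrow> 'a::banach \<Rightarrow> 'a"
  assumes lin: "\<And>s. s \<in> {0..1} \<Longrightarrow> linear (H s)"
    and H: "\<And>s x. s \<in> {0..1} \<Longrightarrow> norm (H s x - x) \<le> c * s * norm x"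
    and H2: "\<And>h m x. h \<ge> 0 \<Longrightarrow> real m * h \<le> 1 \<Longrightarrow>
       norm (H (real m * h) x - x - real m *\<^sub>R (H h x - x)) \<le> d * (real m * h)\<^sup>2 * norm x"
    and "c \<ge> 0" "d \<ge> 0" "t \<ge> 0"
  shows "convergent (\<lambda>n. (H (t / real n) ^^ n) x)"
proof -
  \<comment> \<open>The part \<open>d\<close> comes from \<open>H2\<close>, the other part from
    \<open>funpow_second_order\<close>, where \<open>c * s \<le> c\<close>.\<close>
  define e where "e = d + c\<^sup>2 * exp c"
  have e: "e \<ge> 0" using \<open>d \<ge> 0\<close> by (simp add: e_def)
  \<comment> \<open>For \<open>n \<ge> N\<close> the step \<open>t / n\<close> lies in the unit
    interval, where the hypotheses on \<open>H\<close> hold.\<close>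
  obtain N :: nat where N: "t \<le> real N" using real_arch_simple by blast
  show ?thesis
  proof (rule convergent_if_close_to_multiples)
    fix n m :: nat assume nm: "n \<ge> N" "n \<ge> 1" "m \<ge> 1"
    define s h where "s = t / real n" and "h = s / real m"
    have s: "s \<in> {0..1}" using nm N \<open>t \<ge> 0\<close> by (auto simp: s_def field_simps)
    have h: "h \<in> {0..1}"
      using s nm by (auto simp: h_def field_simps)
    have mh: "real m * h = s" using nm by (simp add: h_def)
    have ns: "real n * s = t" using nm by (simp add: s_def)
    have one_le: "(1 + c * u) \<le> exp (c * u)" for u by simp
    have "norm (H s y - (H h ^^ m) y) \<le> e * s\<^sup>2 * norm y" for y
    proof -
      have "norm (H s y - (H h ^^ m) y) \<le> norm (H s y - y - real m *\<^sub>R (H h y - y))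
          + norm ((H h ^^ m) y - y - real m *\<^sub>R (H h y - y))"
        by (rule order_trans[OF _ norm_triangle_ineq4]) simp
      also have "\<dots> \<le> d * s\<^sup>2 * norm y + (real m * (c * h))\<^sup>2 * exp (real m * (c * h)) * norm y"
        using H2[of h m y] h s mh \<open>c \<ge> 0\<close> funpow_second_order[OF lin[OF h] H[OF h], of m y]
        by (intro add_mono) auto
      also have "\<dots> = d * s\<^sup>2 * norm y + c\<^sup>2 * s\<^sup>2 * exp (c * s) * norm y"
        by (simp add: mh[symmetric] algebra_simps power2_eq_square)
      also have "\<dots> \<le> d * s\<^sup>2 * norm y + c\<^sup>2 * s\<^sup>2 * exp c * norm y"
        using s \<open>c \<ge> 0\<close> by (intro add_left_mono mult_right_mono mult_left_mono) (auto simp: mult_left_le)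
      finally show ?thesis by (simp add: e_def algebra_simps)
    qed
    moreover have "norm (H s y) \<le> exp (c * s) * norm y" for y
      using near_identity_norm_le[OF H[OF s], of y] mult_right_mono[OF one_le[of s], of "norm y"]
      by (smt (verit) norm_ge_zero)
    moreover have "norm ((H h ^^ m) y) \<le> exp (c * s) * norm y" for y
    proof -
      have "norm (H h y) \<le> exp (c * h) * norm y" for y
        using near_identity_norm_le[OF H[OF h], of y] mult_right_mono[OF one_le[of h], of "norm y"]
        by (smt (verit) norm_ge_zero)
      then have "norm ((H h ^^ m) y) \<le> exp (c * h) ^ m * norm y"
        by (rule funpow_norm_le) simp
      also have "exp (c * h) ^ m = exp (c * s)"
        by (simp add: mh[symmetric] exp_of_nat_mult[symmetric] algebra_simps)
      finally show ?thesis .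
    qed
    ultimately have "norm ((H s ^^ n) x - ((H h ^^ m) ^^ n) x)
        \<le> real n * exp (c * s) ^ n * (e * s\<^sup>2) * norm x"
      using s e \<open>c \<ge> 0\<close> by (intro funpow_diff_norm_le lin) auto
    also have "exp (c * s) ^ n = exp (c * t)"
      by (simp add: ns[symmetric] exp_of_nat_mult[symmetric] algebra_simps)
    also have "real n * exp (c * t) * (e * s\<^sup>2) * norm x = (exp (c * t) * e * t\<^sup>2 * norm x) / real n"
      using nm by (simp add: s_def power2_eq_square)
    also have "(H h ^^ m) ^^ n = H h ^^ (n * m)"
      by (simp add: funpow_mult mult.commute)
    finally show "norm ((H (t / real n) ^^ n) x - (H (t / real (n * m)) ^^ (n * m)) x)
        \<le> (exp (c * t) * e * t\<^sup>2 * norm x) / real n"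
      by (simp add: s_def h_def)
  qed
qed

subsection \<open>Strongly continuous semigroups\<close>

text \<open>The functional \<open>f x - i f (i x)\<close> is the standard complex-linear one with
  real part \<open>f\<close>. Homogeneity reduces to real scalars and to multiplication by
  i.\<close>

lemma complex_functional_of_real:
  fixes f :: "'a::complex_banach \<Rightarrow> real"
  assumes "bounded_linear f"
  defines "\<phi> \<equiv> (\<lambda>x. Complex (f x) (- f (\<i> *\<^sub>C x)))"
  shows "bounded_linear \<phi>" and "\<phi> (c *\<^sub>C x) = c * \<phi> x"
proof -
  interpret f: bounded_linear f by fact
  have split: "c *\<^sub>C x = Re c *\<^sub>R x + Im c *\<^sub>R (\<i> *\<^sub>C x)" for c and x :: 'a
  proof -
    have "c *\<^sub>C x = (complex_of_real (Re c) + complex_of_real (Im c) * \<i>) *\<^sub>C x"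
      using complex_eq[of c] by (simp only: mult.commute)
    then show ?thesis by (simp only: scaleC_add_left scaleC_scaleC[symmetric] scaleC_of_real)
  qed
  have i: "\<i> *\<^sub>C \<i> *\<^sub>C x = - x" for x :: 'a
    using scaleC_of_real[of "-1" x] by (simp add: scaleC_scaleC)
  have iR: "\<i> *\<^sub>C (r *\<^sub>R x) = r *\<^sub>R (\<i> *\<^sub>C x)" for r and x :: 'a
    by (metis scaleC_of_real scaleC_scaleC mult.commute)
  show scaleC: "\<phi> (c *\<^sub>C x) = c * \<phi> x" for c x
    unfolding \<phi>_def split[of c x]
    by (simp add: complex_eq_iff f.add f.scaleR f.diff f.neg scaleC_add_right iR i algebra_simps)
  obtain K where K: "\<And>x. norm (f x) \<le> norm x * K" using f.bounded by blast
  show "bounded_linear \<phi>"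
  proof (rule bounded_linear_intro)
    show "\<phi> (x + y) = \<phi> x + \<phi> y" for x y
      by (simp add: \<phi>_def complex_eq_iff f.add scaleC_add_right)
    show "\<phi> (r *\<^sub>R x) = r *\<^sub>R \<phi> x" for r x
      by (simp add: \<phi>_def complex_eq_iff f.scaleR iR)
    show "norm (\<phi> x) \<le> norm x * (2 * K)" for x
      using cmod_le[of "\<phi> x"] K[of x] K[of "\<i> *\<^sub>C x"] by (simp add: \<phi>_def norm_scaleC)
  qed
qed

section \<open>Local boundedness and strong continuity of semigroups\<close>

lemma bounded_clinear_opD:
  assumes "bounded_clinear_op f"
  shows "bounded_linear f" "linear f" "f (c *\<^sub>C x) = c *\<^sub>C f x"
  using assms by (auto simp: bounded_clinear_op_def bounded_linear.linear)

lemma c0_semigroup_op: "c0_semigroup T \<Longrightarrow> t \<ge> 0 \<Longrightarrow> bounded_clinear_op (T t)"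
  by (simp add: c0_semigroup_def)

lemma c0_semigroup_0: "c0_semigroup T \<Longrightarrow> T 0 x = x"
  by (simp add: c0_semigroup_def)

lemma c0_semigroup_add: "c0_semigroup T \<Longrightarrow> s \<ge> 0 \<Longrightarrow> t \<ge> 0 \<Longrightarrow> T (s + t) x = T s (T t x)"
  by (simp add: c0_semigroup_def)

lemma c0_semigroup_mult: "c0_semigroup T \<Longrightarrow> h \<ge> 0 \<Longrightarrow> T (real m * h) = T h ^^ m"
proof (induction m)
  case 0
  then show ?case by (simp add: c0_semigroup_def)
next
  case (Suc m)
  then show ?case using c0_semigroup_add[OF Suc.prems(1), of h "real m * h"]
    by (simp add: fun_eq_iff distrib_right add.commute)
qed

text \<open>Here \<open>f\<close> may take the value 0, since \<open>T 0 = id\<close> turns the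
  right-hand limit into continuity at 0 within the half-line.\<close>

lemma c0_semigroup_tendsto:
  assumes T: "c0_semigroup T" and f: "(f \<longlongrightarrow> 0) F" "\<forall>\<^sub>F i in F. f i \<ge> 0"
  shows "((\<lambda>i. T (f i) x) \<longlongrightarrow> x) F"
proof -
  have "continuous (at 0 within {0..}) (\<lambda>t. T t x)"
    using T by (simp add: continuous_within at_within_Ici_at_right c0_semigroup_def)
  then have "((\<lambda>i. T (f i) x) \<longlongrightarrow> T 0 x) F"
    by (rule continuous_within_tendsto_compose) (use f in auto)
  then show ?thesis by (simp add: c0_semigroup_0[OF T])
qed

text \<open>Without a bound near 0 there would be times \<open>\<tau> n\<close> tending to 0 along
  which the operators are unbounded, against uniform boundedness, because
  \<open>T (\<tau> n) x\<close> converges to \<open>x\<close>. A bound on a short interval extends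
  to \<open>{0..b}\<close> by taking powers.\<close>

lemma c0_semigroup_bounded:
  assumes "c0_semigroup T"
  shows "\<exists>M\<ge>1. \<forall>t\<in>{0..b}. \<forall>x. norm (T t x) \<le> M * norm x"
proof -
  note lin = bounded_clinear_opD(1)[OF c0_semigroup_op[OF assms]]
  \<comment> \<open>One number \<open>n\<close> controls both the bound and the length of the
    interval, so that the negation yields a sequence of times.\<close>
  have "\<exists>n::nat. \<forall>t\<in>{0..1 / real (Suc n)}. \<forall>x. norm (T t x) \<le> real n * norm x"
  proof (rule ccontr)
    assume "\<not> ?thesis"
    then have "\<forall>n::nat. \<exists>t y. t \<in> {0..1 / real (Suc n)} \<and> norm (T t y) > real n * norm y"
      by (simp add: not_le Bex_def)
    then obtain \<tau> y where \<tau>: "\<And>n. \<tau> n \<in> {0..1 / real (Suc n)}"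
      and y: "\<And>n. norm (T (\<tau> n) (y n)) > real n * norm (y n)"
      by metis
    have "\<tau> \<longlonglongrightarrow> 0"
      using \<tau> by (intro real_tendsto_sandwich[OF _ _ tendsto_const LIMSEQ_inverse_real_of_nat])
        (auto simp: inverse_eq_divide)
    then have "(\<lambda>n. T (\<tau> n) x) \<longlonglongrightarrow> x" for x
      using \<tau> by (intro c0_semigroup_tendsto[OF assms]) auto
    then have "Bseq (\<lambda>n. T (\<tau> n) x)" for x
      using convergent_imp_Bseq convergent_def by blast
    then have "\<exists>K. \<forall>n\<in>UNIV. norm (T (\<tau> n) x) \<le> K" for x
      by (auto simp: Bseq_def)
    moreover have "bounded_linear (T (\<tau> n))" for n
      using \<tau>[of n] by (intro lin) auto
    ultimately obtain K where K: "\<And>n x. norm (T (\<tau> n) x) \<le> K * norm x"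
      using uniform_boundedness[of UNIV "\<lambda>n. T (\<tau> n)"] by blast
    obtain n :: nat where "K \<le> real n" using real_arch_simple by blast
    then have "K * norm (y n) \<le> real n * norm (y n)" by (intro mult_right_mono) auto
    then show False using K[of n "y n"] y[of n] by linarith
  qed
  then obtain n :: nat
    where n: "\<And>t x. t \<in> {0..1 / real (Suc n)} \<Longrightarrow> norm (T t x) \<le> real n * norm x" by blast
  \<comment> \<open>This \<open>m\<close> makes \<open>t / (m + 1) \<le> 1 / (n + 1)\<close> for all
    \<open>t\<close> in \<open>{0..b}\<close>. The base \<open>real n + 1\<close> below keeps the
    final constant at least 1.\<close>
  obtain m :: nat where m: "\<bar>b\<bar> * real (Suc n) \<le> real m" using real_arch_simple by blast
  have "norm (T t x) \<le> (real n + 1) ^ Suc m * norm x" if t: "t \<in> {0..b}" for t x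
  proof -
    define h where "h = t / real (Suc m)"
    have "h \<in> {0..1 / real (Suc n)}"
      using t m mult_right_mono[of t "\<bar>b\<bar>" "real (Suc n)"] by (auto simp: h_def field_simps)
    then have "norm (T h x) \<le> (real n + 1) * norm x" for x
      using n[of h x] mult_right_mono[of "real n" "real n + 1" "norm x"] by simp
    then have "norm ((T h ^^ Suc m) x) \<le> (real n + 1) ^ Suc m * norm x"
      by (rule funpow_norm_le) simp
    moreover have "T t = T h ^^ Suc m"
      using c0_semigroup_mult[OF assms, of h "Suc m"] t by (simp add: h_def)
    ultimately show ?thesis by simp
  qed
  moreover have "(real n + 1) ^ Suc m \<ge> 1" by (intro one_le_power) simp
  ultimately show ?thesis by blast
qed

text \<open>For \<open>t \<le> s\<close>, the difference \<open>T s x - T t x\<close> is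
  \<open>T t\<close> applied to \<open>T (s - t) x - x\<close>, and \<open>T t\<close> is bounded
  uniformly on the interval; so continuity at 0 propagates to both sides of every point.\<close>

lemma c0_semigroup_continuous_on:
  assumes "c0_semigroup T"
  shows "continuous_on {0..b} (\<lambda>t. T t x)"
proof -
  obtain M where M: "M \<ge> 1" "\<And>t x. t \<in> {0..b} \<Longrightarrow> norm (T t x) \<le> M * norm x"
    using c0_semigroup_bounded[OF assms] by blast
  have bound: "norm (T s x - T t x) \<le> M * norm (T \<bar>s - t\<bar> x - x)"
    if "s \<in> {0..b}" "t \<in> {0..b}" for s t
  proof -
    have *: "norm (T s x - T t x) \<le> M * norm (T (s - t) x - x)"
      if "s \<in> {0..b}" "t \<in> {0..b}" "t \<le> s" for s t
    proof -
      interpret bounded_linear "T t"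
        using that by (intro bounded_clinear_opD(1) c0_semigroup_op assms) auto
      have "T s x - T t x = T t (T (s - t) x - x)"
        using c0_semigroup_add[OF assms, of t "s - t" x] that by (simp add: diff)
      then show ?thesis using M(2) that by simp
    qed
    show ?thesis
      using *[of s t] *[of t s] that by (cases "t \<le> s") (auto simp: norm_minus_commute)
  qed
  have "((\<lambda>s. T s x) \<longlongrightarrow> T t x) (at t within {0..b})" if t: "t \<in> {0..b}" for t
  proof -
    have "((\<lambda>s. \<bar>s - t\<bar>) \<longlongrightarrow> 0) (at t within {0..b})"
      by (auto intro!: tendsto_eq_intros)
    then have "((\<lambda>s. T \<bar>s - t\<bar> x) \<longlongrightarrow> x) (at t within {0..b})"
      by (rule c0_semigroup_tendsto[OF assms]) simp
    then have "((\<lambda>s. M * norm (T \<bar>s - t\<bar> x - x)) \<longlongrightarrow> 0) (at t within {0..b})"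
      by (auto intro!: tendsto_eq_intros)
    then have "((\<lambda>s. T s x - T t x) \<longlongrightarrow> 0) (at t within {0..b})"
      by (rule Lim_null_comparison[rotated])
        (use bound t in \<open>auto simp: eventually_at_filter\<close>)
    then show ?thesis by (simp add: LIM_zero_iff)
  qed
  then show ?thesis by (simp add: continuous_on_def)
qed

text \<open>Some \<open>v = \<integral>\<^sub>0\<^sup>r T(s) x ds\<close> works: it is nonzero because its mean tends to \<open>x\<close> as \<open>r \<rightarrow> 0\<close>.\<close>

lemma exists_lipschitz_vector:
  fixes T :: "real \<Rightarrow> 'a::complex_banach \<Rightarrow> 'a" and x :: 'a
  assumes T: "c0_semigroup T" and "x \<noteq> 0"
  shows "\<exists>v. v \<noteq> 0 \<and> (\<exists>K. \<forall>h\<in>{0..1}. norm (T h v - v) \<le> K * h)"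
proof -
  \<comment> \<open>The integrals below run up to \<open>r + h \<le> 2\<close>.\<close>
  obtain M where M: "M \<ge> 1" "\<And>t y. t \<in> {0..2} \<Longrightarrow> norm (T t y) \<le> M * norm y"
    using c0_semigroup_bounded[OF T] by blast
  let ?f = "\<lambda>t. T t x"
  have cont: "continuous_on {a..b} ?f" if "0 \<le> a" for a b
    by (rule continuous_on_subset[OF c0_semigroup_continuous_on[OF T, of b]]) (use that in auto)
  then have int: "?f integrable_on {a..b}" if "0 \<le> a" for a b
    using that by (intro integrable_continuous_interval)
  have "(?f \<longlongrightarrow> x) (at_right 0)" using T by (simp add: c0_semigroup_def)
  then have "\<forall>\<^sub>F t in at_right 0. dist (T t x) x < norm x / 2"
    using \<open>x \<noteq> 0\<close> by (intro tendstoD) auto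
  then obtain b where b: "b > 0" "\<And>t. 0 < t \<Longrightarrow> t < b \<Longrightarrow> dist (T t x) x < norm x / 2"
    by (auto simp: eventually_at_right_field)
  define r where "r = min 1 (b / 2)"
  have r: "0 < r" "r \<le> 1" "r < b" using b(1) by (auto simp: r_def)
  define v where "v = integral {0..r} ?f"
  \<comment> \<open>On \<open>{0..r}\<close> the orbit stays within \<open>norm x / 2\<close> of
    \<open>x\<close>, so \<open>v\<close> is closer to \<open>r *\<^sub>R x\<close> than that vector
    is to 0.\<close>
  have "norm (integral {0..r} (\<lambda>t. T t x - x)) \<le> norm x / 2 * (r - 0)"
  proof (rule integral_bound)
    show "norm (T t x - x) \<le> norm x / 2" if "t \<in> {0..r}" for t
      using b(2)[of t] that r c0_semigroup_0[OF T, of x] by (cases "t = 0") (auto simp: dist_norm)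
  qed (use r cont in \<open>auto intro!: continuous_intros\<close>)
  moreover have "integral {0..r} (\<lambda>t. T t x - x) = v - r *\<^sub>R x"
    using r int[of 0 r] by (subst integral_diff) (auto simp: v_def)
  ultimately have "norm (v - r *\<^sub>R x) \<le> norm x / 2 * r" by simp
  moreover have "norm (r *\<^sub>R x) > norm x / 2 * r" using r \<open>x \<noteq> 0\<close> by simp
  ultimately have "v \<noteq> 0" by auto
  moreover have "norm (T h v - v) \<le> (2 * (M * norm x)) * h" if h: "h \<in> {0..1}" for h
  proof -
    have T_lin: "bounded_linear (T h)"
      using h by (intro bounded_clinear_opD(1)[OF c0_semigroup_op[OF T]]) auto
    \<comment> \<open>Applying \<open>T h\<close> shifts the interval of integration by
      \<open>h\<close>, so \<open>T h v - v\<close> is a difference of two integrals over intervals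
      of length \<open>h\<close>.\<close>
    have "T h v = integral {0..r} (T h \<circ> ?f)"
      unfolding v_def using T_lin int[of 0 r] by (simp add: integral_linear)
    also have "\<dots> = integral {h - h..(r + h) - h} (\<lambda>t. T (t + h) x)"
      using h c0_semigroup_add[OF T, of h _ x] by (auto simp: add.commute intro!: integral_cong)
    also have "\<dots> = integral {h..r + h} ?f"
      by (rule integral_shift_real_ivl)
    finally have Thv: "T h v = integral {h..r + h} ?f" .
    have "integral {0..h} ?f + integral {h..r + h} ?f = integral {0..r + h} ?f"
      "v + integral {r..r + h} ?f = integral {0..r + h} ?f"
      unfolding v_def using h r by (auto intro!: Henstock_Kurzweil_Integration.integral_combine int)
    then have "T h v - v = integral {r..r + h} ?f - integral {0..h} ?f"
      unfolding Thv by (simp add: algebra_simps)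
    also have "norm \<dots> \<le> M * norm x * (r + h - r) + M * norm x * (h - 0)"
      using h r M cont
      by (intro order_trans[OF norm_triangle_ineq4] add_mono integral_bound) auto
    finally show ?thesis by (simp add: algebra_simps)
  qed
  ultimately show ?thesis by blast
qed

text \<open>Only the steps \<open>1 / n\<close> are sampled, matching the factors in (ii) at
  \<open>t = 1\<close>. At \<open>n = 0\<close> the value is 0, so bounds can be stated for all
  \<open>n\<close>.\<close>

definition diff_quotient :: "(real \<Rightarrow> 'a::real_vector \<Rightarrow> 'a) \<Rightarrow> nat \<Rightarrow> 'a \<Rightarrow> 'a" where
  "diff_quotient T n x = real n *\<^sub>R (T (1 / real n) x - x)"

lemma diff_quotient_clinear:
  assumes "c0_semigroup T"
  shows "bounded_linear (diff_quotient T n)" "diff_quotient T n (c *\<^sub>C x) = c *\<^sub>C diff_quotient T n x"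
proof -
  have op: "bounded_clinear_op (T (1 / real n))"
    by (intro c0_semigroup_op assms) simp
  show "bounded_linear (diff_quotient T n)"
    unfolding diff_quotient_def using bounded_clinear_opD(1)[OF op]
    by (intro bounded_linear_intros)
  have minus: "c *\<^sub>C (y - z) = c *\<^sub>C y - c *\<^sub>C z" for y z :: 'a
    by (metis add_diff_cancel diff_add_cancel scaleC_add_right)
  show "diff_quotient T n (c *\<^sub>C x) = c *\<^sub>C diff_quotient T n x"
    unfolding diff_quotient_def bounded_clinear_opD(3)[OF op] minus[symmetric]
    by (metis scaleC_of_real scaleC_scaleC mult.commute)
qed

subsection \<open>Rank-one projections\<close>

definition trotter_convergent :: "(real \<Rightarrow> 'a::complex_banach \<Rightarrow> 'a) \<Rightarrow> bool" where
  "trotter_convergent T \<longleftrightarrow> (\<forall>P. bounded_projection P \<longrightarrow>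
     (\<forall>x. \<forall>t\<ge>0. convergent (\<lambda>n. ((T (t / real n) \<circ> P) ^^ n) x)))"

text \<open>The projection \<open>P y = \<phi> y *\<^sub>C w\<close> turns the product formula into powers of the scalar
  \<open>\<phi> (T(1/n) w)\<close>, and Bernoulli's inequality bounds their growth from below.\<close>

lemma diff_quotient_Re_bounded_above:
  fixes \<phi> :: "'a::complex_banach \<Rightarrow> complex"
  assumes T: "c0_semigroup T" and conv: "trotter_convergent T"
    and \<phi>: "bounded_linear \<phi>" "\<And>c x. \<phi> (c *\<^sub>C x) = c * \<phi> x" and w: "\<phi> w = 1"
  shows "\<exists>B. \<forall>n. Re (\<phi> (diff_quotient T n w)) \<le> B"
proof -
  interpret \<phi>: bounded_linear \<phi> by fact
  define P where "P y = \<phi> y *\<^sub>C w" for y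
  obtain K where K: "\<And>x. norm (\<phi> x) \<le> norm x * K" using \<phi>.bounded by blast
  have "bounded_linear P"
  proof (rule bounded_linear_intro)
    show "norm (P y) \<le> norm y * (K * norm w)" for y
      using mult_right_mono[OF K[of y], of "norm w"] by (simp add: P_def norm_scaleC mult.assoc)
    show "P (r *\<^sub>R y) = r *\<^sub>R P y" for r y
      by (simp add: P_def \<phi>.scaleR scaleR_conv_of_real scaleC_scaleC[symmetric] scaleC_of_real)
  qed (simp add: P_def \<phi>.add scaleC_add_left)
  then have "bounded_projection P"
    by (auto simp: bounded_projection_def bounded_clinear_op_def P_def \<phi>(2) w scaleC_scaleC)
  then have "convergent (\<lambda>n. ((T (1 / real n) \<circ> P) ^^ n) w)"
    using conv by (simp add: trotter_convergent_def)
  then have "Bseq (\<lambda>n. \<phi> (((T (1 / real n) \<circ> P) ^^ n) w))"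
    by (intro convergent_imp_Bseq) (auto simp: convergent_def intro: \<phi>.tendsto)
  then obtain B where B: "\<And>n. cmod (\<phi> (((T (1 / real n) \<circ> P) ^^ n) w)) \<le> B"
    unfolding Bseq_def by blast
  \<comment> \<open>Each \<open>P\<close> collapses its argument to a multiple of \<open>w\<close>,
    so each factor contributes the scalar \<open>\<phi> (T h w)\<close>.\<close>
  have power: "\<phi> (((T h \<circ> P) ^^ n) w) = \<phi> (T h w) ^ n" if "h \<ge> 0" for h n
    by (induction n)
      (simp_all add: w P_def bounded_clinear_opD(3)[OF c0_semigroup_op[OF T that]] \<phi>(2) mult.commute)
  \<comment> \<open>The maximum with 0 covers \<open>n = 0\<close> and negative real parts;
    otherwise Bernoulli bounds \<open>1 + a\<close> by \<open>B\<close>.\<close>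
  have "Re (\<phi> (diff_quotient T n w)) \<le> max 0 B" for n
  proof (cases "n \<ge> 1 \<and> Re (\<phi> (diff_quotient T n w)) \<ge> 0")
    case True
    define a where "a = Re (\<phi> (diff_quotient T n w))"
    have n: "real n > 0" and a: "a \<ge> 0" using True by (auto simp: a_def)
    have "a = real n * (Re (\<phi> (T (1 / real n) w)) - 1)"
      by (simp add: a_def diff_quotient_def \<phi>.scaleR \<phi>.diff w)
    then have eq: "Re (\<phi> (T (1 / real n) w)) = 1 + a / real n" using n by (simp add: field_simps)
    have "1 + real n * (a / real n) \<le> (1 + a / real n) ^ n"
      by (rule Bernoulli_inequality) (use a n in \<open>simp add: order_trans[of _ 0]\<close>)
    also have "\<dots> \<le> cmod (\<phi> (T (1 / real n) w)) ^ n"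
      using a n complex_Re_le_cmod[of "\<phi> (T (1 / real n) w)"] by (intro power_mono) (auto simp: eq)
    also have "\<dots> \<le> B" using B[of n] power[of "1 / real n" n] by (simp add: norm_power)
    finally show ?thesis using n by (simp add: a_def)
  qed (auto simp: diff_quotient_def not_le Suc_le_eq \<phi>.zero)
  then show ?thesis by blast
qed

text \<open>Along \<open>v\<close> the quotients are bounded by hypothesis, so the component
  \<open>y\<close> in the kernel of \<open>\<phi>\<close> remains. As \<open>\<phi>\<close> is 1 at
  both \<open>v + y\<close> and \<open>v - y\<close>, the one-sided bounds there control the real
  part at \<open>y\<close> from both sides.\<close>

lemma diff_quotient_Re_bounded:
  fixes \<phi> :: "'a::complex_banach \<Rightarrow> complex"
  assumes T: "c0_semigroup T" and conv: "trotter_convergent T"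
    and \<phi>: "bounded_linear \<phi>" "\<And>c x. \<phi> (c *\<^sub>C x) = c * \<phi> x"
    and v: "\<phi> v = 1" "\<And>n. norm (diff_quotient T n v) \<le> K"
  shows "\<exists>B. \<forall>n. \<bar>Re (\<phi> (diff_quotient T n x))\<bar> \<le> B"
proof -
  interpret \<phi>: bounded_linear \<phi> by fact
  obtain L where L: "L \<ge> 0" "\<And>x. norm (\<phi> x) \<le> norm x * L" using \<phi>.nonneg_bounded by blast
  define y where "y = x - \<phi> x *\<^sub>C v"
  have y: "\<phi> y = 0" by (simp add: y_def \<phi>.diff \<phi>(2) v)
  have x: "x = \<phi> x *\<^sub>C v + y" by (simp add: y_def)
  obtain B1 where B1: "\<And>n. Re (\<phi> (diff_quotient T n (v + y))) \<le> B1"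
    using diff_quotient_Re_bounded_above[OF T conv \<phi>, of "v + y"] y v by (auto simp: \<phi>.add)
  obtain B2 where B2: "\<And>n. Re (\<phi> (diff_quotient T n (v - y))) \<le> B2"
    using diff_quotient_Re_bounded_above[OF T conv \<phi>, of "v - y"] y v by (auto simp: \<phi>.diff)
  have "\<bar>Re (\<phi> (diff_quotient T n x))\<bar> \<le> cmod (\<phi> x) * (K * L) + (\<bar>B1\<bar> + \<bar>B2\<bar> + K * L)" for n
  proof -
    interpret q: bounded_linear "diff_quotient T n" by (rule diff_quotient_clinear[OF T])
    have qv: "cmod (\<phi> (diff_quotient T n v)) \<le> K * L"
      using L(2)[of "diff_quotient T n v"] mult_right_mono[OF v(2)[of n] L(1)] by linarith
    have "\<bar>Re (\<phi> (diff_quotient T n y))\<bar> \<le> \<bar>B1\<bar> + \<bar>B2\<bar> + K * L"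
      using B1[of n] B2[of n] abs_Re_le_cmod[of "\<phi> (diff_quotient T n v)"] qv
      by (simp add: q.add q.diff \<phi>.add \<phi>.diff)
    \<comment> \<open>The scalar \<open>\<phi> x\<close> is complex, so the modulus of
      \<open>\<phi> (diff_quotient T n v)\<close> enters and not just its real part.\<close>
    moreover have "\<bar>Re (\<phi> x * \<phi> (diff_quotient T n v))\<bar> \<le> cmod (\<phi> x) * (K * L)"
      using abs_Re_le_cmod[of "\<phi> x * \<phi> (diff_quotient T n v)"]
        mult_left_mono[OF qv, of "cmod (\<phi> x)"] by (simp add: norm_mult)
    moreover have "\<phi> (diff_quotient T n x) = \<phi> x * \<phi> (diff_quotient T n v) + \<phi> (diff_quotient T n y)"
      by (subst x) (simp add: q.add \<phi>.add diff_quotient_clinear(2)[OF T] \<phi>(2))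
    ultimately show ?thesis by (simp only: plus_complex.sel)
  qed
  then show ?thesis by blast
qed

text \<open>If \<open>f v \<noteq> 0\<close>, the complexification of \<open>f\<close> is divided by
  its value at \<open>v\<close> to reach the normalization \<open>\<phi> v = 1\<close>. If
  \<open>f v = 0\<close>, then \<open>f\<close> is the difference of \<open>f + g\<close> and
  \<open>g\<close>, neither of which vanishes at \<open>v\<close>.\<close>

lemma diff_quotient_weakly_bounded:
  fixes f :: "'a::complex_banach \<Rightarrow> real"
  assumes T: "c0_semigroup T" and conv: "trotter_convergent T" and f: "bounded_linear f"
    and v: "v \<noteq> 0" "\<And>n. norm (diff_quotient T n v) \<le> K"
  shows "\<exists>B. \<forall>n. \<bar>f (diff_quotient T n x)\<bar> \<le> B"
proof -
  have nonvanishing: "\<exists>B. \<forall>n. \<bar>f (diff_quotient T n x)\<bar> \<le> B"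
    if f: "bounded_linear f" and fv: "f v \<noteq> 0" for f :: "'a \<Rightarrow> real"
  proof -
    define \<phi> where "\<phi> x = Complex (f x) (- f (\<i> *\<^sub>C x))" for x
    have \<phi>: "bounded_linear \<phi>" "\<And>c x. \<phi> (c *\<^sub>C x) = c * \<phi> x"
      using complex_functional_of_real[OF f] unfolding \<phi>_def by auto
    define d where "d = \<phi> v"
    have d: "d \<noteq> 0" using fv by (auto simp: d_def \<phi>_def complex_eq_iff)
    \<comment> \<open>Evaluating at \<open>d *\<^sub>C x\<close> cancels the division by
      \<open>d\<close>; the remaining real part is \<open>f\<close>.\<close>
    have "\<exists>B. \<forall>n. \<bar>Re (\<phi> (diff_quotient T n (d *\<^sub>C x)) / d)\<bar> \<le> B"
    proof (rule diff_quotient_Re_bounded[OF T conv, of "\<lambda>x. \<phi> x / d"])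
      show "bounded_linear (\<lambda>x. \<phi> x / d)"
        using bounded_linear_compose[OF bounded_linear_divide \<phi>(1)] .
    qed (use v d \<phi>(2) in \<open>auto simp: d_def\<close>)
    then show ?thesis
      using d by (simp add: diff_quotient_clinear(2)[OF T] \<phi>(2)) (simp add: \<phi>_def)
  qed
  obtain g where g: "bounded_linear g" "g v = norm v" using norming_functional by blast
  show ?thesis
  proof (cases "f v = 0")
    case True
    have "bounded_linear (\<lambda>y. f y + g y)" using f g(1) by (rule bounded_linear_add)
    then obtain B1 where B1: "\<And>n. \<bar>f (diff_quotient T n x) + g (diff_quotient T n x)\<bar> \<le> B1"
      using nonvanishing[of "\<lambda>y. f y + g y"] True g v by auto
    obtain B2 where B2: "\<And>n. \<bar>g (diff_quotient T n x)\<bar> \<le> B2"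
      using nonvanishing[of g] g v by auto
    have "\<bar>f (diff_quotient T n x)\<bar> \<le> B1 + B2" for n
      using B1[of n] B2[of n] by linarith
    then show ?thesis by blast
  qed (rule nonvanishing[OF f])
qed

text \<open>Uniform boundedness enters twice: weak bounds give a norm bound at each fixed
  \<open>x\<close>, and these give a bound on the operator norms.\<close>

lemma trotter_convergent_imp_diff_quotient_bounded:
  assumes T: "c0_semigroup T" and conv: "trotter_convergent T"
  shows "\<exists>C\<ge>0. \<forall>n x. norm (diff_quotient T n x) \<le> C * norm x"
proof -
  have "\<exists>B. \<forall>n. norm (diff_quotient T n x) \<le> B" for x
  proof (cases "x = 0")
    case True
    then show ?thesis
      using bounded_linear.linear[OF diff_quotient_clinear(1)[OF T]] by (auto simp: linear_0)
  next
    case False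
    \<comment> \<open>Here \<open>x\<close> only witnesses that the space is nonzero;
      \<open>v\<close> is the vector at which functionals get normalized.\<close>
    obtain v K where v: "v \<noteq> 0" "\<And>h. h \<in> {0..1} \<Longrightarrow> norm (T h v - v) \<le> K * h"
      using exists_lipschitz_vector[OF T False] by blast
    have "norm (diff_quotient T n v) \<le> K" for n
    proof (cases "n = 0")
      case True
      then show ?thesis
        using order_trans[OF norm_ge_zero v(2)[of 1]] by (simp add: diff_quotient_def)
    next
      case False
      then show ?thesis
        using v(2)[of "1 / real n"] by (simp add: diff_quotient_def pos_le_divide_eq mult.commute)
    qed
    then have "\<exists>B. \<forall>y\<in>range (\<lambda>n. diff_quotient T n x). norm y \<le> B"
      using diff_quotient_weakly_bounded[OF T conv _ v(1), of _ K x]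
      by (intro weakly_bounded_imp_bounded) simp
    then show ?thesis by auto
  qed
  then show ?thesis
    using uniform_boundedness[of UNIV "diff_quotient T"] diff_quotient_clinear(1)[OF T] by simp
qed

subsection \<open>The Lipschitz estimate at zero\<close>

text \<open>The floor picks the largest multiple of \<open>1 / n\<close> not exceeding
  \<open>h\<close>; estimates are proved on this grid and then passed to the limit.\<close>

lemma floor_quotient_le:
  assumes "0 \<le> h" "h \<le> 1"
  shows "real (nat \<lfloor>h * real n\<rfloor>) \<le> real n" "real (nat \<lfloor>h * real n\<rfloor>) / real n \<le> 1"
proof -
  have "real (nat \<lfloor>h * real n\<rfloor>) \<le> h * real n" using assms by simp
  also have "\<dots> \<le> real n" using assms by (simp add: mult_left_le_one_le)
  finally show *: "real (nat \<lfloor>h * real n\<rfloor>) \<le> real n" .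
  then show "real (nat \<lfloor>h * real n\<rfloor>) / real n \<le> 1" by (simp add: divide_le_eq)
qed

lemma floor_quotient_tendsto:
  assumes "0 \<le> h"
  shows "(\<lambda>n. real (nat \<lfloor>h * real n\<rfloor>) / real n) \<longlonglongrightarrow> h"
proof (rule real_tendsto_sandwich)
  show "(\<lambda>n. h - 1 / real n) \<longlonglongrightarrow> h"
    using tendsto_diff[OF tendsto_const lim_const_over_n, of h 1] by simp
  show "(\<lambda>n. h) \<longlonglongrightarrow> h" by simp
  have "h - 1 / real n \<le> real (nat \<lfloor>h * real n\<rfloor>) / real n"
    "real (nat \<lfloor>h * real n\<rfloor>) / real n \<le> h" if "n \<ge> 1" for n
  proof -
    have "h * real n - 1 \<le> real (nat \<lfloor>h * real n\<rfloor>)" "real (nat \<lfloor>h * real n\<rfloor>) \<le> h * real n"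
      using assms by simp_all
    then show "h - 1 / real n \<le> real (nat \<lfloor>h * real n\<rfloor>) / real n"
      "real (nat \<lfloor>h * real n\<rfloor>) / real n \<le> h"
      using that divide_right_mono[of "h * real n - 1" "real (nat \<lfloor>h * real n\<rfloor>)" "real n"]
      by (simp_all add: diff_divide_distrib pos_divide_le_eq)
  qed
  then show "\<forall>\<^sub>F n in sequentially. h - 1 / real n \<le> real (nat \<lfloor>h * real n\<rfloor>) / real n"
    "\<forall>\<^sub>F n in sequentially. real (nat \<lfloor>h * real n\<rfloor>) / real n \<le> h"
    by (auto simp: eventually_sequentially)
qed

definition lipschitz_at_0 :: "(real \<Rightarrow> 'a::real_normed_vector \<Rightarrow> 'a) \<Rightarrow> real \<Rightarrow> bool" where
  "lipschitz_at_0 T C \<longleftrightarrow> C \<ge> 0 \<and> (\<forall>h\<in>{0..1}. \<forall>x. norm (T h x - x) \<le> C * h * norm x)"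

text \<open>On the grid, \<open>T (k / n) - I\<close> is a sum of \<open>k\<close> terms
  \<open>T (j / n) (T (1 / n) - I)\<close>, each of norm at most \<open>M * C / n\<close>. Strong
  continuity extends the estimate to real \<open>h\<close>.\<close>

lemma diff_quotient_bounded_imp_lipschitz:
  assumes T: "c0_semigroup T" and C: "C \<ge> 0" "\<And>n x. norm (diff_quotient T n x) \<le> C * norm x"
  shows "\<exists>C. lipschitz_at_0 T C"
proof -
  obtain M where M: "M \<ge> 1" "\<And>t y. t \<in> {0..1} \<Longrightarrow> norm (T t y) \<le> M * norm y"
    using c0_semigroup_bounded[OF T] by blast
  have step: "norm (T (real k / real n) x - x) \<le> real k / real n * (M * C * norm x)"
    if "k \<le> n" "n \<ge> 1" for k n x
    using that(1)
  proof (induction k)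
    case 0
    then show ?case by (simp add: c0_semigroup_0[OF T])
  next
    case (Suc k)
    let ?t = "real k / real n"
    interpret bounded_linear "T ?t"
      by (intro bounded_clinear_opD(1)[OF c0_semigroup_op[OF T]]) simp
    have q: "T (1 / real n) x - x = (1 / real n) *\<^sub>R diff_quotient T n x"
      using that(2) by (simp add: diff_quotient_def)
    have "T (real (Suc k) / real n) x = T ?t (T (1 / real n) x)"
      using c0_semigroup_add[OF T, of ?t "1 / real n" x] by (simp add: add_divide_distrib add.commute)
    then have "T (real (Suc k) / real n) x - x
        = T ?t (T (1 / real n) x - x) + (T ?t x - x)"
      by (simp add: diff)
    also have "norm \<dots> \<le> M * norm (T (1 / real n) x - x) + ?t * (M * C * norm x)"
      using Suc that(2) by (intro norm_triangle_mono M(2)) auto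
    also have "\<dots> \<le> M * ((1 / real n) * (C * norm x)) + ?t * (M * C * norm x)"
      unfolding q using C(2)[of n x] M(1)
      by (intro add_right_mono mult_left_mono) (auto simp: divide_right_mono)
    also have "\<dots> = real (Suc k) / real n * (M * C * norm x)"
      by (simp add: algebra_simps add_divide_distrib)
    finally show ?case .
  qed
  have "norm (T h x - x) \<le> (M * C) * h * norm x" if h: "h \<in> {0..1}" for h x
  proof -
    define k where "k n = nat \<lfloor>h * real n\<rfloor>" for n
    have lim: "(\<lambda>n. real (k n) / real n) \<longlonglongrightarrow> h"
      unfolding k_def using h by (intro floor_quotient_tendsto) auto
    have k: "k n \<le> n" "real (k n) / real n \<in> {0..1}" for n
      unfolding k_def using h floor_quotient_le[of h n] by auto
    have "(\<lambda>n. T (real (k n) / real n) x) \<longlonglongrightarrow> T h x"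
      by (rule continuous_on_tendsto_compose[OF c0_semigroup_continuous_on[OF T] lim h]) (use k in simp)
    then have "(\<lambda>n. norm (T (real (k n) / real n) x - x)) \<longlonglongrightarrow> norm (T h x - x)"
      by (intro tendsto_intros)
    moreover have "(\<lambda>n. real (k n) / real n * (M * C * norm x)) \<longlonglongrightarrow> h * (M * C * norm x)"
      by (intro tendsto_mult lim tendsto_const)
    ultimately have "norm (T h x - x) \<le> h * (M * C * norm x)"
      using step k(1) by (intro LIMSEQ_le) blast+
    then show ?thesis by (simp add: algebra_simps)
  qed
  then show ?thesis using M(1) C(1) unfolding lipschitz_at_0_def by (intro exI[of _ "M * C"]) auto
qed

text \<open>Convergence at \<open>x\<close> bounds the quotients for small \<open>h\<close>, and
  local boundedness of \<open>T\<close> bounds them for the remaining \<open>h\<close>; uniform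
  boundedness then yields one constant for all \<open>x\<close>.\<close>

lemma gen_domain_UNIV_imp_lipschitz:
  assumes T: "c0_semigroup T" and "gen_domain T = UNIV"
  shows "\<exists>C. lipschitz_at_0 T C"
proof -
  obtain M where M: "M \<ge> 1" "\<And>t y. t \<in> {0..1} \<Longrightarrow> norm (T t y) \<le> M * norm y"
    using c0_semigroup_bounded[OF T] by blast
  have "\<exists>K. \<forall>h\<in>{0<..1}. norm ((1 / h) *\<^sub>R (T h x - x)) \<le> K" for x
  proof -
    obtain y where "((\<lambda>h. (1 / h) *\<^sub>R (T h x - x)) \<longlongrightarrow> y) (at_right 0)"
      using assms(2) by (auto simp: gen_domain_def)
    then have "\<forall>\<^sub>F h in at_right 0. dist ((1 / h) *\<^sub>R (T h x - x)) y < 1"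
      by (rule tendstoD) simp
    then obtain b where b: "b > 0" "\<And>h. 0 < h \<Longrightarrow> h < b \<Longrightarrow> dist ((1 / h) *\<^sub>R (T h x - x)) y < 1"
      by (auto simp: eventually_at_right_field)
    have "norm ((1 / h) *\<^sub>R (T h x - x)) \<le> (norm y + 1) + (M + 1) * norm x / b"
      if h: "h \<in> {0<..1}" for h
    proof (cases "h < b")
      case True
      have "norm ((1 / h) *\<^sub>R (T h x - x)) \<le> norm y + 1"
        using b(2)[OF _ True] h norm_triangle_sub[of "(1 / h) *\<^sub>R (T h x - x)" y]
        by (simp add: dist_norm)
      moreover have "(M + 1) * norm x / b \<ge> 0" using b M by simp
      ultimately show ?thesis by linarith
    next
      case False
      have "norm (T h x - x) \<le> (M + 1) * norm x"
        using M(2)[of h x] h norm_triangle_ineq4[of "T h x" x] by (simp add: algebra_simps)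
      then have "norm (T h x - x) / h \<le> (M + 1) * norm x / b"
        using False b h M by (intro frac_le) auto
      moreover have "norm ((1 / h) *\<^sub>R (T h x - x)) = norm (T h x - x) / h" using h by simp
      ultimately show ?thesis using norm_ge_zero[of y] by linarith
    qed
    then show ?thesis by blast
  qed
  moreover have "bounded_linear (\<lambda>x. (1 / h) *\<^sub>R (T h x - x))" if "h \<in> {0<..1}" for h
    using bounded_clinear_opD(1)[OF c0_semigroup_op[OF T, of h]] that
    by (intro bounded_linear_intros) auto
  ultimately obtain K where K: "K \<ge> 0"
      "\<And>h x. h \<in> {0<..1} \<Longrightarrow> norm ((1 / h) *\<^sub>R (T h x - x)) \<le> K * norm x"
    using uniform_boundedness[of "{0<..1}" "\<lambda>h x. (1 / h) *\<^sub>R (T h x - x)"] by blast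
  have "norm (T h x - x) \<le> K * h * norm x" if "h \<in> {0..1}" for h x
  proof (cases "h = 0")
    case False
    then show ?thesis
      using K(2)[of h x] that by (simp add: pos_divide_le_eq algebra_simps(1) mult.commute mult.left_commute)
  qed (simp add: c0_semigroup_0[OF T])
  then show ?thesis using K(1) unfolding lipschitz_at_0_def by blast
qed

section \<open>Consequences of the Lipschitz estimate\<close>

lemma lipschitz_second_order:
  assumes T: "c0_semigroup T" and C: "lipschitz_at_0 T C" and h: "h \<ge> 0" "real m * h \<le> 1"
  shows "norm (T (real m * h) x - x - real m *\<^sub>R (T h x - x)) \<le> C\<^sup>2 * exp C * (real m * h)\<^sup>2 * norm x"
proof (cases "m = 0")
  case False
  have C0: "C \<ge> 0" using C by (simp add: lipschitz_at_0_def)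
  have "1 * h \<le> real m * h" using False h by (intro mult_right_mono) auto
  then have h1: "h \<in> {0..1}" using h by auto
  \<comment> \<open>\<open>T (m * h)\<close> is the \<open>m\<close>-th power of \<open>T h\<close>,
    to which the second-order estimate for powers applies with \<open>a = C * h\<close>.\<close>
  have "norm (T (real m * h) x - x - real m *\<^sub>R (T h x - x))
      \<le> (real m * (C * h))\<^sup>2 * exp (real m * (C * h)) * norm x"
    unfolding c0_semigroup_mult[OF T h(1)]
    using C h1 bounded_clinear_opD(2)[OF c0_semigroup_op[OF T h(1)]]
    by (intro funpow_second_order) (auto simp: lipschitz_at_0_def)
  also have "\<dots> \<le> (real m * (C * h))\<^sup>2 * exp C * norm x"
    using mult_left_mono[OF h(2) C0]
    by (intro mult_right_mono mult_left_mono) (auto simp: algebra_simps)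
  finally show ?thesis by (simp add: power_mult_distrib algebra_simps)
qed (simp add: c0_semigroup_0[OF T])

text \<open>Since \<open>1 / n\<close> is \<open>m\<close> steps of length
  \<open>1 / (n * m)\<close>, the second-order estimate compares the quotients at \<open>n\<close>
  and \<open>n * m\<close>, so they converge to some \<open>L x\<close>. The same estimate at real
  \<open>h\<close> identifies \<open>L\<close> as the generator.\<close>

lemma lipschitz_imp_bounded_generator:
  assumes T: "c0_semigroup T" and C: "lipschitz_at_0 T C"
  shows "bounded_generator T"
proof -
  define D where "D = C\<^sup>2 * exp C"
  have "convergent (\<lambda>n. diff_quotient T n x)" for x
  proof (rule convergent_if_close_to_multiples)
    fix n m :: nat assume nm: "n \<ge> 0" "n \<ge> 1" "m \<ge> 1"
    have "diff_quotient T n x - diff_quotient T (n * m) x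
        = real n *\<^sub>R (T (real m * (1 / real (n * m))) x - x - real m *\<^sub>R (T (1 / real (n * m)) x - x))"
      using nm by (simp add: diff_quotient_def algebra_simps)
    also have "norm \<dots> \<le> real n * (D * (real m * (1 / real (n * m)))\<^sup>2 * norm x)"
      unfolding norm_scaleR D_def using nm
      by (intro mult_mono lipschitz_second_order T C) (auto simp: field_simps)
    also have "\<dots> = D * norm x / real n" using nm by (simp add: power2_eq_square field_simps)
    finally show "norm (diff_quotient T n x - diff_quotient T (n * m) x) \<le> D * norm x / real n" .
  qed
  then obtain L where L: "\<And>x. (\<lambda>n. diff_quotient T n x) \<longlonglongrightarrow> L x"
    unfolding convergent_def by metis
  \<comment> \<open>Convergence along \<open>1 / n\<close> alone does not give the limit over all
    \<open>h\<close>. The estimate at the grid points \<open>u n\<close> passes to an expansion at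
    \<open>h\<close>, with \<open>L\<close> in place of the quotient.\<close>
  have second: "norm (T h x - x - h *\<^sub>R L x) \<le> D * h\<^sup>2 * norm x" if h: "h \<in> {0..1}" for h x
  proof -
    define u where "u n = real (nat \<lfloor>h * real n\<rfloor>) / real n" for n
    have lim: "u \<longlonglongrightarrow> h"
      unfolding u_def using h by (intro floor_quotient_tendsto) auto
    have u: "u n \<in> {0..1}" for n
      unfolding u_def using h floor_quotient_le by auto
    have "(\<lambda>n. T (u n) x) \<longlonglongrightarrow> T h x"
      by (rule continuous_on_tendsto_compose[OF c0_semigroup_continuous_on[OF T] lim h]) (use u in simp)
    then have "(\<lambda>n. norm (T (u n) x - x - u n *\<^sub>R diff_quotient T n x)) \<longlonglongrightarrow> norm (T h x - x - h *\<^sub>R L x)"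
      by (intro tendsto_intros lim L)
    moreover have "(\<lambda>n. D * (u n)\<^sup>2 * norm x) \<longlonglongrightarrow> D * h\<^sup>2 * norm x"
      by (intro tendsto_intros lim)
    moreover have "norm (T (u n) x - x - u n *\<^sub>R diff_quotient T n x) \<le> D * (u n)\<^sup>2 * norm x"
      if "n \<ge> 1" for n
      using lipschitz_second_order[OF T C, of "1 / real n" "nat \<lfloor>h * real n\<rfloor>" x] u[of n] that
      by (simp add: u_def D_def diff_quotient_def)
    ultimately show ?thesis by (intro LIMSEQ_le) blast+
  qed
  have lim: "((\<lambda>h. (1 / h) *\<^sub>R (T h x - x)) \<longlongrightarrow> L x) (at_right 0)" for x
  proof -
    have "((\<lambda>h. (1 / h) *\<^sub>R (T h x - x) - L x) \<longlongrightarrow> 0) (at_right 0)"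
    proof (rule Lim_null_comparison)
      have "norm ((1 / h) *\<^sub>R (T h x - x) - L x) \<le> D * h * norm x" if "0 < h" "h < 1" for h
      proof -
        have "(1 / h) *\<^sub>R (T h x - x) - L x = (1 / h) *\<^sub>R (T h x - x - h *\<^sub>R L x)"
          using that by (simp add: scaleR_diff_right)
        then show ?thesis
          using mult_left_mono[OF second[of h x], of "1 / h"] that
          by (simp only: norm_scaleR) (simp add: power2_eq_square)
      qed
      then show "\<forall>\<^sub>F h in at_right 0. norm ((1 / h) *\<^sub>R (T h x - x) - L x) \<le> D * h * norm x"
        unfolding eventually_at_right_field by (intro exI[of _ 1]) auto
      show "((\<lambda>h. D * h * norm x) \<longlongrightarrow> 0) (at_right 0)"
        by (auto intro!: tendsto_eq_intros)
    qed
    then show ?thesis by (simp add: LIM_zero_iff)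
  qed
  have gen: "generator T x = L x" for x
    unfolding generator_def using lim by (intro tendsto_Lim) auto
  have "norm (L x) \<le> C * norm x" for x
  proof (rule Lim_norm_ubound[OF _ L])
    have "norm (diff_quotient T n x) \<le> C * norm x" if "n \<ge> 1" for n
    proof -
      have "norm (T (1 / real n) x - x) \<le> C * (1 / real n) * norm x"
        using C that unfolding lipschitz_at_0_def by (auto simp del: times_divide_eq_right)
      then show ?thesis
        using that by (simp add: diff_quotient_def pos_le_divide_eq mult.commute)
    qed
    then show "\<forall>\<^sub>F n in sequentially. norm (diff_quotient T n x) \<le> C * norm x"
      by (auto simp: eventually_sequentially)
  qed simp
  moreover have "gen_domain T = UNIV"
    using lim unfolding gen_domain_def by blast
  ultimately show ?thesis unfolding bounded_generator_def gen by blast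
qed

text \<open>\<open>P T(s)\<close> need not be near the identity, but \<open>H s\<close> is, and both
  agree on the range of \<open>P\<close>. So \<open>P\<close> applied to the \<open>n\<close>-th
  product is a power of \<open>H\<close> at \<open>P x\<close>, which converges, and the product
  itself differs from it by O(1/n).\<close>

lemma lipschitz_imp_trotter_convergent:
  assumes T: "c0_semigroup T" and C: "lipschitz_at_0 T C"
  shows "trotter_convergent T"
  unfolding trotter_convergent_def
proof (intro allI impI)
  fix P :: "'a \<Rightarrow> 'a" and x :: 'a and t :: real
  assume P: "bounded_projection P" and t: "t \<ge> 0"
  have C': "C \<ge> 0" "\<And>h x. h \<in> {0..1} \<Longrightarrow> norm (T h x - x) \<le> C * h * norm x"
    using C by (auto simp: lipschitz_at_0_def)
  interpret P: bounded_linear P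
    using P by (simp add: bounded_projection_def bounded_clinear_op_def)
  have PP: "P (P y) = P y" for y
    using P unfolding bounded_projection_def by (metis o_apply)
  obtain p where p: "p \<ge> 0" "\<And>y. norm (P y) \<le> norm y * p" using P.nonneg_bounded by blast
  define H where "H s y = y + P (T s y - y)" for s y
  have H: "norm (H s y - y) \<le> (p * C) * s * norm y" if "s \<in> {0..1}" for s y
    using p(2)[of "T s y - y"] mult_right_mono[OF C'(2)[OF that, of y] p(1)]
    by (simp add: H_def algebra_simps)
  have conv: "convergent (\<lambda>n. (H (t / real n) ^^ n) (P x))"
  \<comment> \<open>Both constants are those of \<open>T\<close> multiplied by the bound
    \<open>p\<close> of \<open>P\<close>.\<close>
  proof (rule near_identity_powers_convergent[where c = "p * C" and d = "p * (C\<^sup>2 * exp C)"])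
    show "linear (H s)" if "s \<in> {0..1}" for s
    proof -
      have "linear (T s)" using that by (intro bounded_clinear_opD(2)[OF c0_semigroup_op[OF T]]) auto
      then show ?thesis
        by (intro linearI) (simp_all add: H_def linear_add linear_cmul P.diff P.add P.scaleR algebra_simps)
    qed
    show "norm (H (real m * h) y - y - real m *\<^sub>R (H h y - y))
        \<le> p * (C\<^sup>2 * exp C) * (real m * h)\<^sup>2 * norm y" if "h \<ge> 0" "real m * h \<le> 1" for h m y
    proof -
      have "H (real m * h) y - y - real m *\<^sub>R (H h y - y)
          = P (T (real m * h) y - y - real m *\<^sub>R (T h y - y))"
        by (simp add: H_def P.diff P.scaleR)
      then show ?thesis
        using p(2)[of "T (real m * h) y - y - real m *\<^sub>R (T h y - y)"]
          mult_right_mono[OF lipschitz_second_order[OF T C that, of y] p(1)]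
        by (simp add: algebra_simps)
    qed
  qed (use H p C' t in auto)
  have PT: "P (((T s \<circ> P) ^^ n) x) = (H s ^^ n) (P x)" for s n
  proof -
    have "P (T s (P u)) = H s (P u)" for u by (simp add: H_def P.diff PP)
    then have step: "P (((T s \<circ> P) ^^ Suc n) x) = H s (P (((T s \<circ> P) ^^ n) x))" for n by simp
    show ?thesis
    proof (induction n)
      case (Suc n)
      then show ?case by (simp only: step) simp
    qed simp
  qed
  let ?a = "\<lambda>n. (H (t / real n) ^^ n) (P x)" and ?b = "\<lambda>n. ((T (t / real n) \<circ> P) ^^ n) x"
  have "(\<lambda>n. ?b n - ?a n) \<longlonglongrightarrow> 0"
  proof (rule Lim_null_comparison)
    \<comment> \<open>The factor \<open>C + p * C\<close> adds up the first-order deviations of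
      \<open>T s\<close> and \<open>H s\<close> from the identity; the last factor bounds
      \<open>norm z\<close>.\<close>
    let ?K = "(C + p * C) * t * (exp (p * C * t) * norm (P x))"
    show "(\<lambda>n. ?K / real n) \<longlonglongrightarrow> 0" by (rule lim_const_over_n)
    obtain N :: nat where N: "t \<le> real N" using real_arch_simple by blast
    have "norm (?b n - ?a n) \<le> ?K / real n" if n: "n \<ge> max 1 N" for n
    proof -
      define s where "s = t / real n"
      have s: "s \<in> {0..1}" using n N t by (auto simp: s_def)
      \<comment> \<open>Splitting off the outermost factor leaves the same vector \<open>z\<close>
        under \<open>T s\<close> and under \<open>H s\<close>.\<close>
      obtain j where j: "n = Suc j" using n by (cases n) auto
      define z where "z = (H s ^^ j) (P x)"
      have pC: "p * C * s \<ge> 0" using p(1) C'(1) s by simp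
      have "norm (H s y) \<le> exp (p * C * s) * norm y" for y
        using near_identity_norm_le[OF H[OF s], of y]
          mult_right_mono[OF exp_ge_add_one_self[of "p * C * s"], of "norm y"] by (smt (verit) norm_ge_zero)
      then have "norm z \<le> exp (p * C * s) ^ j * norm (P x)"
        unfolding z_def by (intro funpow_norm_le) auto
      also have "\<dots> \<le> exp (p * C * s) ^ n * norm (P x)"
        using pC by (intro mult_right_mono power_increasing) (auto simp: j)
      also have "exp (p * C * s) ^ n = exp (p * C * t)"
        using n by (simp add: s_def exp_of_nat_mult[symmetric])
      finally have z: "norm z \<le> exp (p * C * t) * norm (P x)" .
      have "?b n - ?a n = (T s z - z) - (H s z - z)"
        unfolding s_def[symmetric] using PT[of j s] by (simp add: j z_def)
      also have "norm \<dots> \<le> C * s * norm z + (p * C) * s * norm z"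
        by (intro order_trans[OF norm_triangle_ineq4] add_mono C'(2)[OF s] H[OF s])
      also have "\<dots> = (C + p * C) * s * norm z" by (simp add: algebra_simps)
      also have "\<dots> \<le> (C + p * C) * s * (exp (p * C * t) * norm (P x))"
        using z p(1) C'(1) s by (intro mult_left_mono) auto
      finally show ?thesis by (simp add: s_def)
    qed
    then show "\<forall>\<^sub>F n in sequentially. norm (?b n - ?a n) \<le> ?K / real n"
      unfolding eventually_sequentially by blast
  qed
  then show "convergent ?b"
    using conv convergent_add[OF _ conv, of "\<lambda>n. ?b n - ?a n"] by (auto simp: convergent_def)
qed

theorem theorem1:
  fixes T :: "real \<Rightarrow> 'a::complex_banach \<Rightarrow> 'a"
  assumes "c0_semigroup T"
  shows "bounded_generator T \<longleftrightarrow>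
    (\<forall>P. bounded_projection P \<longrightarrow>
       (\<forall>x. \<forall>t\<ge>0. convergent (\<lambda>n. ((T (t / real n) \<circ> P) ^^ n) x)))"
proof -
  have "bounded_generator T \<longleftrightarrow> trotter_convergent T"
  proof
    assume "bounded_generator T"
    then obtain C where "lipschitz_at_0 T C"
      using gen_domain_UNIV_imp_lipschitz[OF assms] by (auto simp: bounded_generator_def)
    then show "trotter_convergent T"
      by (rule lipschitz_imp_trotter_convergent[OF assms])
  next
    assume "trotter_convergent T"
    then obtain C where "C \<ge> 0" "\<And>n x. norm (diff_quotient T n x) \<le> C * norm x"
      using trotter_convergent_imp_diff_quotient_bounded[OF assms] by blast
    then obtain C' where "lipschitz_at_0 T C'"
      using diff_quotient_bounded_imp_lipschitz[OF assms] by blast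
    then show "bounded_generator T"
      by (rule lipschitz_imp_bounded_generator[OF assms])
  qed
  then show ?thesis by (simp only: trotter_convergent_def)
qed

end
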